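(* Let $X=[x_1,\dots,x_n]$ be a finite set of vectors in $\mathbb{R}^m$ (the columns of a real matrix), all of which are nonzero. Then $X$ has a minimal subspace segmentation.
   Context: A real matrix $X=[x_1,\dots,x_n]$ is identified with the (indexed) finite set of its columns; a subset $X'$ of $X$ is a column submatrix. $r(X')$ and $n(X')$ denote the rank and the number of columns of $X'$, and $\mathrm{span}(X')$ its column space. $X'$ is "of full rank" if $r(X')=n(X')$. A set $X'$ is nondegenerate if every subset of $X'$ with rank smaller than $r(X')$ is of full column rank (equivalently $r(X'')=\min\{n(X''),r(X')\}$ for every subset $X''$ of $X'$). A sample subspace $\mathrm{span}(X')$ (together with its spanning set $X'$) is minimal if (1) $n(X')>r(X')$ and (2) $X'$ is nondegenerate. It is pure if $n(X')=r(X')$. A minimal subspace segmentation (MSS) of $X$ is a partition of the columns of $X$ into nonempty segments $X_0,X_1,\dots,X_K$ ($K\ge 0$; the segment $X_0$ is allowed to be absent) such that: (1) $\mathrm{span}(X_0)$ is pure if $X_0$ exists, and each $\mathrm{span}(X_k)$, $k=1,\dots,K$, is minimal; (2) $\mathrm{span}(X_k)\ne\mathrm{span}(X_\ell)$ for all $k\neq\ell$ among the existing segments; (3) if $X_0$ exists, then for every $x_j\in X_0$, $x_j\notin\mathrm{span}(X_k)$ for $k=1,\dots,K$. *)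

theory Defs
  imports "HOL-Analysis.Analysis"
begin

text \<open>
  A column submatrix of \<open>X\<close> is given by the set \<open>S\<close> of its column indices, not by the set of
  its column vectors, so that repeated columns are counted with multiplicity.
\<close>

definition colspan :: "real^'n^'m \<Rightarrow> 'n set \<Rightarrow> (real^'m) set" where
  "colspan X S = span ((\<lambda>j. column j X) ` S)"

definition colrank :: "real^'n^'m \<Rightarrow> 'n set \<Rightarrow> nat" where
  "colrank X S = dim (colspan X S)"

definition full_rank :: "real^'n^'m \<Rightarrow> 'n set \<Rightarrow> bool" where
  "full_rank X S \<longleftrightarrow> colrank X S = card S"

definition nondegenerate :: "real^'n^'m \<Rightarrow> 'n set \<Rightarrow> bool" where
  "nondegenerate X S \<longleftrightarrow> (\<forall>T\<subseteq>S. colrank X T < colrank X S \<longrightarrow> full_rank X T)"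

definition minimal_subspace :: "real^'n^'m \<Rightarrow> 'n set \<Rightarrow> bool" where
  "minimal_subspace X S \<longleftrightarrow> card S > colrank X S \<and> nondegenerate X S"

definition pure_subspace :: "real^'n^'m \<Rightarrow> 'n set \<Rightarrow> bool" where
  "pure_subspace X S \<longleftrightarrow> card S = colrank X S"

text \<open>
  The segments are \<open>S 0, \<dots>, S K\<close>; the values of \<open>S\<close> beyond \<open>K\<close> are irrelevant.
  Segments are nonempty, so \<open>S 0 = {}\<close> encodes that the segment with index 0 is absent.
\<close>

definition is_MSS :: "real^'n^'m \<Rightarrow> nat \<Rightarrow> (nat \<Rightarrow> 'n set) \<Rightarrow> bool" where
  "is_MSS X K S \<longleftrightarrow>
     (\<Union>k\<in>{0..K}. S k) = UNIV \<and>
     disjoint_family_on S {0..K} \<and>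
     (\<forall>k\<in>{1..K}. S k \<noteq> {}) \<and>
     (S 0 \<noteq> {} \<longrightarrow> pure_subspace X (S 0)) \<and>
     (\<forall>k\<in>{1..K}. minimal_subspace X (S k)) \<and>
     (\<forall>k\<in>{0..K}. \<forall>l\<in>{0..K}. k \<noteq> l \<and> S k \<noteq> {} \<and> S l \<noteq> {} \<longrightarrow>
        colspan X (S k) \<noteq> colspan X (S l)) \<and>
     (S 0 \<noteq> {} \<longrightarrow> (\<forall>j\<in>S 0. \<forall>k\<in>{1..K}. column j X \<notin> colspan X (S k)))"

end

theory Submission imports Defs begin

text \<open>
  Among the dependent sets of columns choose one of least rank, and let the first segment consist
  of all columns in its span. No dependent set has smaller rank, so this segment is minimal; and no
  remaining column lies in its span, so any segmentation of the remaining columns can be extended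
  by it. When the remaining columns are independent, they form the pure segment.
\<close>

text \<open>The conditions of \<open>is_MSS\<close> relative to an index set \<open>R\<close>: the
  induction deletes columns while the matrix \<open>X\<close> and its type stay fixed.\<close>

definition segmentation_on :: "real^'n^'m \<Rightarrow> 'n set \<Rightarrow> nat \<Rightarrow> (nat \<Rightarrow> 'n set) \<Rightarrow> bool" where
  "segmentation_on X R K S \<longleftrightarrow>
     (\<Union>k\<in>{0..K}. S k) = R \<and>
     disjoint_family_on S {0..K} \<and>
     (\<forall>k\<in>{1..K}. S k \<noteq> {}) \<and>
     (S 0 \<noteq> {} \<longrightarrow> pure_subspace X (S 0)) \<and>
     (\<forall>k\<in>{1..K}. minimal_subspace X (S k)) \<and>
     (\<forall>k\<in>{0..K}. \<forall>l\<in>{0..K}. k \<noteq> l \<and> S k \<noteq> {} \<and> S l \<noteq> {} \<longrightarrow>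
        colspan X (S k) \<noteq> colspan X (S l)) \<and>
     (S 0 \<noteq> {} \<longrightarrow> (\<forall>j\<in>S 0. \<forall>k\<in>{1..K}. column j X \<notin> colspan X (S k)))"

lemma column_in_colspan: "j \<in> S \<Longrightarrow> column j X \<in> colspan X S"
  unfolding colspan_def by (simp add: span_base)

lemma colrank_le_card:
  fixes X :: "real^'n^'m"
  shows "colrank X S \<le> card S"
proof -
  have "dim ((\<lambda>j. column j X) ` S) \<le> card ((\<lambda>j. column j X) ` S)"
    by (rule dim_le_card') simp
  also have "\<dots> \<le> card S"
    by (rule card_image_le) simp
  finally show ?thesis
    by (simp add: colrank_def colspan_def dim_span)
qed

text \<open>The added columns already lie in the span, and \<open>T\<close> is among the columns
  collected. A dependent set can thus be enlarged without changing its rank.\<close>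

lemma colspan_closure:
  assumes "T \<subseteq> R"
  shows "colspan X {j \<in> R. column j X \<in> colspan X T} = colspan X T"
proof (rule subset_antisym)
  show "colspan X {j \<in> R. column j X \<in> colspan X T} \<subseteq> colspan X T"
    unfolding colspan_def by (rule span_minimal) auto
  show "colspan X T \<subseteq> colspan X {j \<in> R. column j X \<in> colspan X T}"
    using assms column_in_colspan[of _ T X] unfolding colspan_def by (intro span_mono) auto
qed

lemma ex_minimal_flat:
  fixes X :: "real^'n^'m"
  assumes "colrank X R < card R"
  obtains C where "C \<subseteq> R" "C \<noteq> {}" "minimal_subspace X C"
    "\<And>j. j \<in> R - C \<Longrightarrow> column j X \<notin> colspan X C"
proof -
  define dependent_in where "dependent_in T \<longleftrightarrow> T \<subseteq> R \<and> colrank X T < card T" for T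
  have "dependent_in R"
    using assms by (simp add: dependent_in_def)
  then obtain T where T: "dependent_in T"
    and least: "\<And>U. dependent_in U \<Longrightarrow> colrank X T \<le> colrank X U"
    using exists_least_iff[of "\<lambda>r. \<exists>T. dependent_in T \<and> colrank X T = r"]
    by (metis not_le)
  \<comment> \<open>\<open>T\<close> itself need not do: columns of \<open>R\<close> outside
    \<open>T\<close> may lie in its span, which the last conclusion forbids for the segment.\<close>
  define C where "C = {j \<in> R. column j X \<in> colspan X T}"
  have "T \<subseteq> R"
    using T by (simp add: dependent_in_def)
  then have span_C: "colspan X C = colspan X T"
    unfolding C_def by (rule colspan_closure)
  then have rank_C: "colrank X C = colrank X T"
    by (simp add: colrank_def)
  have "T \<subseteq> C"
    using \<open>T \<subseteq> R\<close> column_in_colspan by (auto simp: C_def)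
  then have "card T \<le> card C"
    by (intro card_mono) simp_all
  then have card_C: "colrank X C < card C"
    using T rank_C by (simp add: dependent_in_def)
  show thesis
  proof
    show "C \<subseteq> R"
      by (auto simp: C_def)
    show "C \<noteq> {}"
      using card_C by auto
    \<comment> \<open>A subset of \<open>C\<close> without full rank would be a dependent subset of
      \<open>R\<close>, so its rank could not be below the least one.\<close>
    have "full_rank X U" if "U \<subseteq> C" "colrank X U < colrank X C" for U
    proof -
      have "\<not> dependent_in U"
        using least[of U] that rank_C by auto
      then show ?thesis
        using that \<open>C \<subseteq> R\<close> colrank_le_card[of X U]
        by (auto simp: dependent_in_def full_rank_def)
    qed
    then show "minimal_subspace X C"
      using card_C by (auto simp: minimal_subspace_def nondegenerate_def)
    show "column j X \<notin> colspan X C" if "j \<in> R - C" for j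
      using that span_C by (simp add: C_def)
  qed
qed

text \<open>The one-sided hypothesis \<open>sep\<close> suffices: it yields disjointness, unequal
  spans and the condition on the pure segment. Columns of \<open>C\<close> may still lie in the span
  of an old minimal segment.\<close>

lemma segmentation_on_extend:
  assumes seg: "segmentation_on X R K S"
    and C: "C \<noteq> {}" "minimal_subspace X C"
    and sep: "\<And>j. j \<in> R \<Longrightarrow> column j X \<notin> colspan X C"
  shows "segmentation_on X (R \<union> C) (Suc K) (S(Suc K := C))"
proof -
  have sub: "S k \<subseteq> R" if "k \<le> K" for k
    using seg that unfolding segmentation_on_def by auto
  have disj: "S k \<inter> C = {}" if "k \<le> K" for k
    using sub[OF that] sep column_in_colspan by blast
  \<comment> \<open>Any column of \<open>S k\<close> lies in the span of \<open>S k\<close> but, by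
    \<open>sep\<close>, not in that of \<open>C\<close>.\<close>
  have distinct: "colspan X (S k) \<noteq> colspan X C" if "k \<le> K" "S k \<noteq> {}" for k
    using sub[OF that(1)] sep column_in_colspan that(2) by blast
  have ivl0: "{0..Suc K} = insert (Suc K) {0..K}"
    and ivl1: "{1..Suc K} = insert (Suc K) {1..K}"
    by auto
  have union: "(\<Union>k\<in>{0..Suc K}. (S(Suc K := C)) k) = R \<union> C"
    using seg unfolding ivl0 segmentation_on_def by auto
  have family: "disjoint_family_on (S(Suc K := C)) {0..Suc K}"
    using seg disj unfolding ivl0 segmentation_on_def disjoint_family_on_def
    by (auto simp: Int_commute)
  have spans: "\<forall>k\<in>{0..Suc K}. \<forall>l\<in>{0..Suc K}.
      k \<noteq> l \<and> (S(Suc K := C)) k \<noteq> {} \<and> (S(Suc K := C)) l \<noteq> {} \<longrightarrow>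
      colspan X ((S(Suc K := C)) k) \<noteq> colspan X ((S(Suc K := C)) l)"
    using seg distinct unfolding segmentation_on_def
    by (metis atLeastAtMost_iff fun_upd_apply le_Suc_eq)
  have pure: "\<forall>j\<in>S 0. \<forall>k\<in>{1..Suc K}. column j X \<notin> colspan X ((S(Suc K := C)) k)"
  proof (intro ballI)
    fix j k assume "j \<in> S 0" "k \<in> {1..Suc K}"
    then show "column j X \<notin> colspan X ((S(Suc K := C)) k)"
      using seg sep[of j] sub[of 0] unfolding ivl1 segmentation_on_def
      by (cases "k = Suc K") auto
  qed
  show ?thesis
    unfolding segmentation_on_def using union family spans pure
  proof (intro conjI)
    show "\<forall>k\<in>{1..Suc K}. (S(Suc K := C)) k \<noteq> {}"
      "\<forall>k\<in>{1..Suc K}. minimal_subspace X ((S(Suc K := C)) k)"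
      using seg C unfolding ivl1 segmentation_on_def by auto
    show "(S(Suc K := C)) 0 \<noteq> {} \<longrightarrow> pure_subspace X ((S(Suc K := C)) 0)"
      using seg unfolding segmentation_on_def by simp
  qed simp_all
qed

lemma ex_segmentation_on:
  fixes X :: "real^'n^'m"
  shows "\<exists>K S. segmentation_on X R K S"
proof (induction "card R" arbitrary: R rule: less_induct)
  case less
  show ?case
  proof (cases "colrank X R < card R")
    case False
    then have "pure_subspace X R"
      using colrank_le_card[of X R] by (simp add: pure_subspace_def)
    \<comment> \<open>With last index 0 there is only the pure segment; if \<open>R\<close> is
      empty, the same choice encodes its absence.\<close>
    then have "segmentation_on X R 0 (\<lambda>_. R)"
      by (simp add: segmentation_on_def disjoint_family_on_def)
    then show ?thesis
      by blast
  next
    case True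
    then obtain C where C: "C \<subseteq> R" "C \<noteq> {}" "minimal_subspace X C"
      and sep: "\<And>j. j \<in> R - C \<Longrightarrow> column j X \<notin> colspan X C"
      using ex_minimal_flat by blast
    have "card (R - C) < card R"
      using C(1,2) by (intro psubset_card_mono) auto
    then obtain K S where "segmentation_on X (R - C) K S"
      using less by blast
    \<comment> \<open>The new segment is appended after index \<open>K\<close>, so index 0 stays
      reserved for the pure segment.\<close>
    from segmentation_on_extend[OF this C(2,3) sep]
    have "segmentation_on X R (Suc K) (S(Suc K := C))"
      using C(1) by (simp add: Un_absorb2)
    then show ?thesis
      by blast
  qed
qed

theorem theorem1:
  fixes X :: "real^'n^'m"
  assumes "\<And>j. column j X \<noteq> 0"
  shows "\<exists>K S. is_MSS X K S"
  using ex_segmentation_on[of X UNIV] unfolding segmentation_on_def is_MSS_def .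

end
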